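(* Suppose that the chromatic number of a finitely generated right-angled Coxeter group $\Gamma$, with finite Coxeter generating set $S$, is $n$. Then the Cayley graph $C(\Gamma,S)$ admits an equivariant isometric embedding into the product of $n$ simplicial trees.
   Context: A finitely generated right-angled Coxeter group is a group $\Gamma$ together with a finite set $S$ of generators such that every element of $S$ has order two and all relations in $\Gamma$ are consequences of these and of relations of the form $st=ts$ with $s,t\in S$. A colouring is a map $c:S\to\{1,\dots,n\}$ such that $c(s)\neq c(t)$ for all distinct $s,t\in S$ with $st=ts$; the chromatic number of $\Gamma$ is the minimal number $n$ of colours needed. The Cayley graph $C(\Gamma,S)$ has vertex set $\Gamma$ and an edge between $\gamma$ and $\gamma s$ for each $\gamma\in\Gamma$, $s\in S$; $\Gamma$ acts on it by left multiplication. Graphs and trees always carry the simplicial metric, in which every edge has length $1$. A product of trees carries the $l_1$-product metric, i.e. the distance is the sum of the distances in the factors. Equivariant means equivariant with respect to the action of $\Gamma$ on $C(\Gamma,S)$ and the diagonal action on the product coming from actions of $\Gamma$ on the $n$ trees. The trees are not required to be locally finite.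
   Formalization: The embedding is isometric on the vertex set Γ and maps edges to edges; distances between interior points of edges are not compared, since for two distinct commuting generators the 4-cycle, as a circle of length 4, has no isometric embedding into a finite l1-product of trees. *)

theory Defs
  imports "HOL-Algebra.Algebra"
begin

text \<open>Words over the alphabet \<open>S \<union> S\<^sup>-\<^sup>1\<close>: the letter \<open>(s, True)\<close> stands for \<open>s\<close> and
  \<open>(s, False)\<close> for its formal inverse.\<close>

type_synonym 'a group_word = "('a \<times> bool) list"

definition group_words :: "'a set \<Rightarrow> 'a group_word set"
  where "group_words S = lists (S \<times> UNIV)"

definition word_value :: "('a, 'b) monoid_scheme \<Rightarrow> 'a group_word \<Rightarrow> 'a"
  where "word_value G w =
    foldr (\<lambda>(s, b) x. (if b then s else inv\<^bsub>G\<^esub> s) \<otimes>\<^bsub>G\<^esub> x) w \<one>\<^bsub>G\<^esub>"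

text \<open>\<open>consequence S R u v\<close>: the relation \<open>u = v\<close> between words over \<open>S \<union> S\<^sup>-\<^sup>1\<close> is a consequence
  of the relations in \<open>R\<close>, i.e. it holds in the group presented by \<open>\<langle>S | R\<rangle>\<close>.\<close>

inductive consequence ::
  "'a set \<Rightarrow> ('a group_word \<times> 'a group_word) set \<Rightarrow> 'a group_word \<Rightarrow> 'a group_word \<Rightarrow> bool"
  for S R where
  rel: "(u, v) \<in> R \<Longrightarrow> consequence S R u v"
| cancel: "s \<in> S \<Longrightarrow> consequence S R [(s, b), (s, \<not> b)] []"
| refl: "w \<in> group_words S \<Longrightarrow> consequence S R w w"
| sym: "consequence S R u v \<Longrightarrow> consequence S R v u"
| trans: "consequence S R u v \<Longrightarrow> consequence S R v w \<Longrightarrow> consequence S R u w"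
| congr: "consequence S R u v \<Longrightarrow> x \<in> group_words S \<Longrightarrow> y \<in> group_words S
    \<Longrightarrow> consequence S R (x @ u @ y) (x @ v @ y)"

definition has_presentation ::
  "('a, 'b) monoid_scheme \<Rightarrow> 'a set \<Rightarrow> ('a group_word \<times> 'a group_word) set \<Rightarrow> bool"
  where "has_presentation G S R \<longleftrightarrow>
    group G \<and> S \<subseteq> carrier G \<and> generate G S = carrier G \<and>
    (\<forall>u\<in>group_words S. \<forall>v\<in>group_words S.
      word_value G u = word_value G v \<longleftrightarrow> consequence S R u v)"

definition right_angled_relations ::
  "('a, 'b) monoid_scheme \<Rightarrow> 'a set \<Rightarrow> ('a group_word \<times> 'a group_word) set"
  where "right_angled_relations G S =
    {([(s, True), (s, True)], []) | s. s \<in> S} \<union>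
    {([(s, True), (t, True)], [(t, True), (s, True)]) | s t.
      s \<in> S \<and> t \<in> S \<and> s \<otimes>\<^bsub>G\<^esub> t = t \<otimes>\<^bsub>G\<^esub> s}"

definition right_angled_coxeter_group :: "('a, 'b) monoid_scheme \<Rightarrow> 'a set \<Rightarrow> bool"
  where "right_angled_coxeter_group G S \<longleftrightarrow>
    finite S \<and> (\<forall>s\<in>S. group.ord G s = 2) \<and>
    has_presentation G S (right_angled_relations G S)"

definition colouring :: "('a, 'b) monoid_scheme \<Rightarrow> 'a set \<Rightarrow> nat \<Rightarrow> ('a \<Rightarrow> nat) \<Rightarrow> bool"
  where "colouring G S n c \<longleftrightarrow>
    c \<in> S \<rightarrow> {1..n} \<and>
    (\<forall>s\<in>S. \<forall>t\<in>S. s \<noteq> t \<and> s \<otimes>\<^bsub>G\<^esub> t = t \<otimes>\<^bsub>G\<^esub> s \<longrightarrow> c s \<noteq> c t)"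

definition chromatic_number :: "('a, 'b) monoid_scheme \<Rightarrow> 'a set \<Rightarrow> nat"
  where "chromatic_number G S = (LEAST n. \<exists>c. colouring G S n c)"

text \<open>Undirected simple graphs are given by a vertex set and a set of two-element edges; neither
  finiteness nor local finiteness is required.\<close>

definition simple_graph :: "'v set \<Rightarrow> 'v set set \<Rightarrow> bool"
  where "simple_graph V E \<longleftrightarrow> (\<forall>e\<in>E. e \<subseteq> V \<and> card e = 2)"

definition graph_walk :: "'v set \<Rightarrow> 'v set set \<Rightarrow> 'v list \<Rightarrow> bool"
  where "graph_walk V E p \<longleftrightarrow>
    p \<noteq> [] \<and> set p \<subseteq> V \<and> (\<forall>i. Suc i < length p \<longrightarrow> {p ! i, p ! Suc i} \<in> E)"

definition connected_graph :: "'v set \<Rightarrow> 'v set set \<Rightarrow> bool"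
  where "connected_graph V E \<longleftrightarrow>
    V \<noteq> {} \<and> (\<forall>u\<in>V. \<forall>v\<in>V. \<exists>p. graph_walk V E p \<and> hd p = u \<and> last p = v)"

definition graph_cycle :: "'v set \<Rightarrow> 'v set set \<Rightarrow> 'v list \<Rightarrow> bool"
  where "graph_cycle V E p \<longleftrightarrow>
    graph_walk V E p \<and> distinct p \<and> 3 \<le> length p \<and> {last p, hd p} \<in> E"

definition simplicial_tree :: "'v set \<Rightarrow> 'v set set \<Rightarrow> bool"
  where "simplicial_tree V E \<longleftrightarrow>
    simple_graph V E \<and> connected_graph V E \<and> (\<nexists>p. graph_cycle V E p)"

text \<open>The simplicial metric (all edges of length 1) between vertices. It is only meaningful for
  vertices joined by a walk.\<close>

definition graph_dist :: "'v set \<Rightarrow> 'v set set \<Rightarrow> 'v \<Rightarrow> 'v \<Rightarrow> nat"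
  where "graph_dist V E u v =
    (LEAST k. \<exists>p. graph_walk V E p \<and> hd p = u \<and> last p = v \<and> length p = Suc k)"

definition cayley_edges :: "('a, 'b) monoid_scheme \<Rightarrow> 'a set \<Rightarrow> 'a set set"
  where "cayley_edges G S = {{g, g \<otimes>\<^bsub>G\<^esub> s} | g s. g \<in> carrier G \<and> s \<in> S}"

definition simplicial_action ::
  "('a, 'b) monoid_scheme \<Rightarrow> 'v set \<Rightarrow> 'v set set \<Rightarrow> ('a \<Rightarrow> 'v \<Rightarrow> 'v) \<Rightarrow> bool"
  where "simplicial_action G V E \<phi> \<longleftrightarrow>
    group_action G V \<phi> \<and> (\<forall>g\<in>carrier G. \<forall>e\<in>E. \<phi> g ` e \<in> E)"

text \<open>The product of the graphs \<open>(V i, E i)\<close>, \<open>i \<in> I\<close>: vertices, edges (of the product cube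
  complex), \<open>l\<^sub>1\<close>-metric and diagonal action.\<close>

definition product_verts :: "'i set \<Rightarrow> ('i \<Rightarrow> 'v set) \<Rightarrow> ('i \<Rightarrow> 'v) set"
  where "product_verts I V = (\<Pi>\<^sub>E i\<in>I. V i)"

definition product_edges ::
  "'i set \<Rightarrow> ('i \<Rightarrow> 'v set) \<Rightarrow> ('i \<Rightarrow> 'v set set) \<Rightarrow> ('i \<Rightarrow> 'v) set set"
  where "product_edges I V E =
    {{x, y} | x y. x \<in> product_verts I V \<and> y \<in> product_verts I V \<and>
      (\<exists>i\<in>I. {x i, y i} \<in> E i \<and> (\<forall>j\<in>I - {i}. x j = y j))}"

definition l1_dist ::
  "'i set \<Rightarrow> ('i \<Rightarrow> 'v set) \<Rightarrow> ('i \<Rightarrow> 'v set set) \<Rightarrow> ('i \<Rightarrow> 'v) \<Rightarrow> ('i \<Rightarrow> 'v) \<Rightarrow> nat"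
  where "l1_dist I V E x y = (\<Sum>i\<in>I. graph_dist (V i) (E i) (x i) (y i))"

definition diagonal_action ::
  "'i set \<Rightarrow> ('i \<Rightarrow> 'a \<Rightarrow> 'v \<Rightarrow> 'v) \<Rightarrow> 'a \<Rightarrow> ('i \<Rightarrow> 'v) \<Rightarrow> ('i \<Rightarrow> 'v)"
  where "diagonal_action I \<phi> g x = (\<lambda>i\<in>I. \<phi> i g (x i))"

text \<open>Isometric embedding of the Cayley graph into the product of the graphs \<open>(V i, E i)\<close>.
  Vertices go to vertices and edges to edges, and the distances compared are those between
  vertices. Distances between interior points of edges cannot be preserved: if distinct
  \<open>s, t \<in> S\<close> commute, then \<open>1, s, st, t\<close> span a 4-cycle of \<open>C(\<Gamma>,S)\<close>; its opposite edges have
  midpoints at distance 2 in \<open>C(\<Gamma>,S)\<close>, but the cycle bounds a unit square of the product of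
  trees, in which these midpoints are at \<open>l\<^sub>1\<close>-distance 1.\<close>

definition cayley_isometric_embedding ::
  "('a, 'b) monoid_scheme \<Rightarrow> 'a set \<Rightarrow> 'i set \<Rightarrow> ('i \<Rightarrow> 'v set) \<Rightarrow> ('i \<Rightarrow> 'v set set)
    \<Rightarrow> ('a \<Rightarrow> 'i \<Rightarrow> 'v) \<Rightarrow> bool"
  where "cayley_isometric_embedding G S I V E f \<longleftrightarrow>
    f \<in> carrier G \<rightarrow> product_verts I V \<and>
    (\<forall>e\<in>cayley_edges G S. f ` e \<in> product_edges I V E) \<and>
    (\<forall>g\<in>carrier G. \<forall>h\<in>carrier G.
      l1_dist I V E (f g) (f h) = graph_dist (carrier G) (cayley_edges G S) g h)"

definition cayley_equivariant ::
  "('a, 'b) monoid_scheme \<Rightarrow> 'i set \<Rightarrow> ('i \<Rightarrow> 'a \<Rightarrow> 'v \<Rightarrow> 'v) \<Rightarrow> ('a \<Rightarrow> 'i \<Rightarrow> 'v) \<Rightarrow> bool"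
  where "cayley_equivariant G I \<phi> f \<longleftrightarrow>
    (\<forall>g\<in>carrier G. \<forall>h\<in>carrier G. f (g \<otimes>\<^bsub>G\<^esub> h) = diagonal_action I \<phi> g (f h))"

end

theory Submission
  imports Defs
begin

text \<open>For a set \<open>A\<close> of generators let \<open>inversions A g\<close> be the set of reflections in the walls of type
  \<open>A\<close> that separate \<open>\<one>\<close> from \<open>g\<close>. The complementary regions of these walls form a graph on which
  the group acts, and the distance of two regions is the number of walls of type \<open>A\<close> between them.
  If no two distinct elements of \<open>A\<close> commute, then these walls do not cross, by the description of
  the centralizer of a generator, so the graph is a tree. Sending a group element to the regions
  containing it, one for each colour class, yields the embedding; it is isometric because a
  shortest word crosses no wall twice, hence its length is the total number of walls crossed.\<close>

section \<open>Symmetric differences and adjacent repetitions in lists\<close>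

lemma sym_diff_assoc: "sym_diff (sym_diff A B) C = sym_diff A (sym_diff B C)"
  by blast

lemma sym_diff_cancel_left: "sym_diff (sym_diff A B) (sym_diff A C) = sym_diff B C"
  by blast

lemma sym_diff_sym_diff: "sym_diff A (sym_diff A B) = B"
  by blast

lemma sym_diff_eq_empty: "sym_diff A B = {} \<longleftrightarrow> A = B"
  by blast

lemma image_sym_diff:
  assumes "inj_on f C" "U \<subseteq> C" "T \<subseteq> C"
  shows "f ` sym_diff U T = sym_diff (f ` U) (f ` T)"
  using assms by (auto simp: inj_on_def)

lemma not_distinct_adjE:
  assumes "\<not> distinct_adj u"
  obtains p a q where "u = p @ a # a # q"
proof -
  have "\<exists>p a q. u = p @ a # a # q"
    using assms
  proof (induction u)
    case (Cons x u)
    show ?case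
    proof (cases "distinct_adj u")
      case True
      with Cons.prems obtain q where "u = x # q"
        by (cases u) auto
      then show ?thesis
        by (metis append_Nil)
    next
      case False
      then show ?thesis
        using Cons.IH by (metis append_Cons)
    qed
  qed auto
  then show ?thesis
    using that by blast
qed

lemma all_nat_split: "(\<forall>i. P i) \<longleftrightarrow> P 0 \<and> (\<forall>i. P (Suc i))"
  by (metis not0_implies_Suc)

section \<open>Walks and distances in graphs\<close>

lemma graph_walk_Cons:
  "graph_walk V E (x # p) \<longleftrightarrow> x \<in> V \<and> (p = [] \<or> {x, hd p} \<in> E \<and> graph_walk V E p)"
proof (cases p)
  case (Cons y q)
  have "(\<forall>i. Suc i < length (x # p) \<longrightarrow> {(x # p) ! i, (x # p) ! Suc i} \<in> E) \<longleftrightarrow>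
      {x, y} \<in> E \<and> (\<forall>i. Suc i < length p \<longrightarrow> {p ! i, p ! Suc i} \<in> E)"
    using Cons by (subst all_nat_split) simp
  then show ?thesis
    unfolding graph_walk_def using Cons by auto
qed (auto simp: graph_walk_def)

text \<open>\<open>M\<close> acts as a potential: an edge changes it by one element, so a walk with
  few edges cannot change it by much. Finiteness is carried along because \<open>card\<close> of an
  infinite set is 0.\<close>

lemma graph_walk_potential:
  assumes "graph_walk V E p"
    and "\<And>x y. {x, y} \<in> E \<Longrightarrow> \<exists>r. sym_diff (M x) (M y) = {r}"
  shows "finite (sym_diff (M (hd p)) (M (last p))) \<and>
    card (sym_diff (M (hd p)) (M (last p))) < length p"
  using assms(1)
proof (induction p)
  case (Cons x p)
  show ?case
  proof (cases "p = []")
    case False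
    with Cons.prems have e: "{x, hd p} \<in> E" and w: "graph_walk V E p"
      by (auto simp: graph_walk_Cons)
    obtain r where r: "sym_diff (M x) (M (hd p)) = {r}"
      using assms(2) e by blast
    let ?D = "sym_diff (M (hd p)) (M (last p))"
    have sub: "sym_diff (M x) (M (last p)) \<subseteq> insert r ?D"
      using r by blast
    have fin: "finite ?D" and lt: "card ?D < length p"
      using Cons.IH w by auto
    have "card (sym_diff (M x) (M (last p))) \<le> card (insert r ?D)"
      using sub fin by (intro card_mono) auto
    also have "\<dots> \<le> Suc (card ?D)"
      using fin by (simp add: card_insert_if)
    finally have "card (sym_diff (M x) (M (last p))) < length (x # p)"
      using lt by simp
    moreover have "finite (sym_diff (M x) (M (last p)))"
      using sub fin by (meson finite.insertI finite_subset)
    ultimately show ?thesis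
      using False by simp
  qed simp
qed (simp add: graph_walk_def)

text \<open>The potential bounds every walk from below and \<open>p\<close> attains the bound. Later
  \<open>M\<close> is the set of walls separating a vertex from the base point.\<close>

lemma graph_dist_eq_card:
  assumes "graph_walk V E p" "hd p = x" "last p = y"
    and "length p = Suc (card (sym_diff (M x) (M y)))"
    and "\<And>x y. {x, y} \<in> E \<Longrightarrow> \<exists>r. sym_diff (M x) (M y) = {r}"
  shows "graph_dist V E x y = card (sym_diff (M x) (M y))"
  unfolding graph_dist_def
proof (rule Least_equality)
  fix k
  assume "\<exists>p. graph_walk V E p \<and> hd p = x \<and> last p = y \<and> length p = Suc k"
  then show "card (sym_diff (M x) (M y)) \<le> k"
    using graph_walk_potential [of V E _ M] assms(5) by fastforce
qed (use assms in auto)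

section \<open>Words in the generators and the universal property\<close>

locale racg = group G for G :: "('a, 'b) monoid_scheme" (structure) +
  fixes S :: "'a set"
  assumes racg: "right_angled_coxeter_group G S"
begin

lemma S_carrier: "s \<in> S \<Longrightarrow> s \<in> carrier G"
  using racg unfolding right_angled_coxeter_group_def has_presentation_def by blast

lemma S_ord: "s \<in> S \<Longrightarrow> ord s = 2"
  using racg unfolding right_angled_coxeter_group_def by blast

lemma S_square: "s \<in> S \<Longrightarrow> s \<otimes> s = \<one>"
  using pow_ord_eq_1 [of s] S_carrier S_ord by (simp add: numeral_2_eq_2)

lemma S_inv: "s \<in> S \<Longrightarrow> inv s = s"
  using S_square S_carrier by (simp add: inv_equality)

lemma S_cancel: "s \<in> S \<Longrightarrow> x \<in> carrier G \<Longrightarrow> s \<otimes> (s \<otimes> x) = x"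
  using S_square S_carrier by (simp flip: m_assoc)

text \<open>Every generator is its own inverse, so words without signs suffice.\<close>

definition val :: "'a list \<Rightarrow> 'a"
  where "val w = foldr (\<otimes>) w \<one>"

lemma val_Nil [simp]: "val [] = \<one>"
  and val_Cons [simp]: "val (s # w) = s \<otimes> val w"
  by (simp_all add: val_def)

lemma val_carrier [simp, intro]: "w \<in> lists S \<Longrightarrow> val w \<in> carrier G"
  by (induction w) (auto simp: S_carrier)

lemma val_append [simp]:
  "u \<in> lists S \<Longrightarrow> v \<in> lists S \<Longrightarrow> val (u @ v) = val u \<otimes> val v"
  by (induction u) (auto simp: S_carrier m_assoc)

lemma val_rev: "w \<in> lists S \<Longrightarrow> val (rev w) = inv (val w)"
proof (induction w rule: list.induct)
  case (Cons s w)
  then have "rev w \<in> lists S"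
    by auto
  with Cons show ?case
    by (simp add: S_carrier S_inv inv_mult_group)
qed simp

lemma val_surj:
  assumes "g \<in> carrier G"
  obtains w where "w \<in> lists S" "val w = g"
proof -
  have "g \<in> generate G S"
    using assms racg unfolding right_angled_coxeter_group_def has_presentation_def by blast
  then have "\<exists>w\<in>lists S. val w = g"
  proof induction
    case one
    then show ?case by (auto intro!: bexI [of _ "[]"])
  next
    case (incl h)
    then show ?case by (auto intro!: bexI [of _ "[h]"] simp: S_carrier)
  next
    case (inv h)
    then show ?case by (auto intro!: bexI [of _ "[h]"] simp: S_carrier S_inv)
  next
    case (eng h1 h2)
    then obtain u v where "u \<in> lists S" "val u = h1" "v \<in> lists S" "val v = h2"
      by blast
    then show ?case
      by (intro bexI [of _ "u @ v"]) auto
  qed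
  then show ?thesis
    using that by blast
qed

lemma word_value_map_fst:
  "u \<in> group_words S \<Longrightarrow> word_value G u = val (map fst u)"
  unfolding group_words_def word_value_def
  by (induction u) (auto simp: S_inv)

lemma map_fst_group_words: "u \<in> group_words S \<Longrightarrow> map fst u \<in> lists S"
  unfolding group_words_def by (induction u) auto

lemma foldr_in:
  assumes "\<And>s x. s \<in> S \<Longrightarrow> x \<in> M \<Longrightarrow> F s x \<in> M" "w \<in> lists S" "x \<in> M"
  shows "foldr F w x \<in> M"
  using assms(2) by (induction w) (auto simp: assms)

text \<open>The universal property of the presentation: an assignment of pairwise commuting (where
  required) involutions of \<open>M\<close> to the generators extends to an action of the group.\<close>

lemma foldr_cong_val:
  assumes F_in: "\<And>s x. s \<in> S \<Longrightarrow> x \<in> M \<Longrightarrow> F s x \<in> M"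
    and F_inv: "\<And>s x. s \<in> S \<Longrightarrow> x \<in> M \<Longrightarrow> F s (F s x) = x"
    and F_comm: "\<And>s t x. s \<in> S \<Longrightarrow> t \<in> S \<Longrightarrow> s \<otimes> t = t \<otimes> s \<Longrightarrow> x \<in> M
      \<Longrightarrow> F s (F t x) = F t (F s x)"
    and "u \<in> lists S" "v \<in> lists S" "val u = val v" "x \<in> M"
  shows "foldr F u x = foldr F v x"
proof -
  \<comment> \<open>Induction on the derivation of the relation. The point \<open>x\<close> stays
    universally quantified because in the case \<open>congr\<close> the hypothesis is applied at the
    image of \<open>x\<close> under the right context.\<close>
  have sound: "\<forall>x\<in>M. foldr F (map fst u) x = foldr F (map fst v) x"
    if "consequence S (right_angled_relations G S) u v" for u v
    using that
  proof induction
    case (rel u v)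
    then consider s where "s \<in> S" "u = [(s, True), (s, True)]" "v = []"
      | s t where "s \<in> S" "t \<in> S" "s \<otimes> t = t \<otimes> s"
          "u = [(s, True), (t, True)]" "v = [(t, True), (s, True)]"
      unfolding right_angled_relations_def by blast
    then show ?case
    proof cases
      case 1
      then show ?thesis by (simp add: F_inv)
    next
      case 2
      then show ?thesis using F_comm [of s t] by simp
    qed
  next
    case (cancel s b)
    then show ?case by (simp add: F_inv)
  next
    case (congr u v p q)
    have "foldr F (map fst q) x \<in> M" if "x \<in> M" for x
      by (rule foldr_in [OF F_in map_fst_group_words]) (use congr that in auto)
    then show ?case
      using congr.IH by simp
  qed simp_all
  \<comment> \<open>Lifting to words with positive letters lets the presentation turn equality of
    values into a derivation.\<close>
  let ?w = "map (\<lambda>s. (s, True))"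
  have gw: "?w w \<in> group_words S" if "w \<in> lists S" for w
    using that by (auto simp: group_words_def)
  have "word_value G (?w u) = word_value G (?w v)"
    using assms(4-6) gw by (simp add: word_value_map_fst comp_def)
  then have "consequence S (right_angled_relations G S) (?w u) (?w v)"
    using racg gw assms(4,5)
    unfolding right_angled_coxeter_group_def has_presentation_def by blast
  from bspec [OF sound [OF this] \<open>x \<in> M\<close>] show ?thesis
    by (simp add: comp_def)
qed

subsection \<open>Inversions and reduced words\<close>

definition conjugate :: "'a \<Rightarrow> 'a \<Rightarrow> 'a"
  where "conjugate g x = g \<otimes> x \<otimes> inv g"

lemma conjugate_carrier [simp]: "g \<in> carrier G \<Longrightarrow> x \<in> carrier G \<Longrightarrow> conjugate g x \<in> carrier G"
  by (simp add: conjugate_def)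

lemma conjugate_mult:
  "g \<in> carrier G \<Longrightarrow> h \<in> carrier G \<Longrightarrow> x \<in> carrier G \<Longrightarrow> conjugate (g \<otimes> h) x = conjugate g (conjugate h x)"
  by (simp add: conjugate_def inv_mult_group m_assoc)

lemma conjugate_one [simp]: "x \<in> carrier G \<Longrightarrow> conjugate \<one> x = x"
  by (simp add: conjugate_def)

lemma conjugate_inj: "g \<in> carrier G \<Longrightarrow> inj_on (conjugate g) (carrier G)"
  by (auto simp: conjugate_def inj_on_def)

lemma conjugate_self: "s \<in> S \<Longrightarrow> conjugate s s = s"
  by (simp add: conjugate_def S_inv S_square S_carrier)

lemma conjugate_eq_iff:
  "g \<in> carrier G \<Longrightarrow> x \<in> carrier G \<Longrightarrow> y \<in> carrier G \<Longrightarrow> conjugate g x = y \<longleftrightarrow> g \<otimes> x = y \<otimes> g"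
  unfolding conjugate_def by (metis inv_solve_right m_closed inv_solve_right')

lemma conjugate_commute:
  "g \<in> carrier G \<Longrightarrow> x \<in> carrier G \<Longrightarrow> g \<otimes> x = x \<otimes> g \<Longrightarrow> conjugate g x = x"
  by (simp add: conjugate_eq_iff)

text \<open>One letter of an affine action on sets of reflections, with symmetric difference as
  addition; it takes the inversions of \<open>g\<close> to those of
  \<open>s \<otimes> g\<close>.\<close>

definition flip :: "'a set \<Rightarrow> 'a \<Rightarrow> 'a set \<Rightarrow> 'a set"
  where "flip A s U = sym_diff (if s \<in> A then {s} else {}) (conjugate s ` U)"

lemma flip_carrier: "s \<in> S \<Longrightarrow> U \<subseteq> carrier G \<Longrightarrow> flip A s U \<subseteq> carrier G"
  unfolding flip_def using S_carrier by auto

lemma flip_empty: "flip A s {} = (if s \<in> A then {s} else {})"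
  by (auto simp: flip_def)

lemma conjugate_image_mult:
  assumes "g \<in> carrier G" "h \<in> carrier G" "U \<subseteq> carrier G"
  shows "conjugate g ` conjugate h ` U = conjugate (g \<otimes> h) ` U"
  unfolding image_image using assms by (intro image_cong refl) (auto simp: conjugate_mult)

lemma conjugate_image_one: "U \<subseteq> carrier G \<Longrightarrow> conjugate \<one> ` U = U"
  by (force simp: image_iff)

lemma flip_flip:
  assumes "s \<in> S" "t \<in> S" "U \<subseteq> carrier G"
  shows "flip A s (flip A t U) = sym_diff (sym_diff (if s \<in> A then {s} else {})
    (if t \<in> A then {conjugate s t} else {})) (conjugate (s \<otimes> t) ` U)"
proof -
  have "conjugate s ` flip A t U = sym_diff (if t \<in> A then {conjugate s t} else {}) (conjugate (s \<otimes> t) ` U)"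
    unfolding flip_def
    using assms S_carrier by (subst image_sym_diff [OF conjugate_inj]) (auto simp: conjugate_image_mult)
  then show ?thesis
    by (simp only: flip_def [of A s] sym_diff_assoc)
qed

definition inversions :: "'a set \<Rightarrow> 'a \<Rightarrow> 'a set"
  where "inversions A g = foldr (flip A) (SOME w. w \<in> lists S \<and> val w = g) {}"

text \<open>The choice of the word is immaterial by \<open>foldr_cong_val\<close>: flips are
  involutions, because conjugation by \<open>s\<close> fixes \<open>s\<close>, and the flips of
  commuting letters commute.\<close>

lemma inversions_val:
  assumes "w \<in> lists S"
  shows "inversions A (val w) = foldr (flip A) w {}"
proof -
  let ?v = "SOME v. v \<in> lists S \<and> val v = val w"
  have v: "?v \<in> lists S \<and> val ?v = val w"
    by (rule someI [of _ w]) (use assms in auto)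
  show ?thesis
    unfolding inversions_def
  proof (rule foldr_cong_val [where M = "Pow (carrier G)"])
    fix s U assume "s \<in> S" "U \<in> Pow (carrier G)"
    then show "flip A s (flip A s U) = U"
      using S_square conjugate_self by (simp add: flip_flip conjugate_image_one)
  next
    fix s t U
    assume "s \<in> S" "t \<in> S" and st: "s \<otimes> t = t \<otimes> s" and "U \<in> Pow (carrier G)"
    moreover from this have "conjugate s t = t" "conjugate t s = s"
      by (simp_all add: conjugate_commute S_carrier)
    ultimately show "flip A s (flip A t U) = flip A t (flip A s U)"
      by (simp add: flip_flip Un_commute)
  qed (use v assms flip_carrier in auto)
qed

lemma foldr_flip_carrier: "w \<in> lists S \<Longrightarrow> U \<subseteq> carrier G \<Longrightarrow> foldr (flip A) w U \<subseteq> carrier G"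
  by (induction w) (auto simp: flip_carrier del: subsetI)

lemma inversions_carrier: "g \<in> carrier G \<Longrightarrow> inversions A g \<subseteq> carrier G"
  by (metis val_surj inversions_val foldr_flip_carrier empty_subsetI)

text \<open>A composition of affine maps is affine: its linear part is conjugation by
  \<open>val w\<close>, its translation part is the value at the empty set.\<close>

lemma foldr_flip:
  assumes "w \<in> lists S" "U \<subseteq> carrier G"
  shows "foldr (flip A) w U = sym_diff (foldr (flip A) w {}) (conjugate (val w) ` U)"
  using assms(1)
proof (induction w rule: list.induct)
  case Nil
  then show ?case using assms by (simp add: conjugate_image_one)
next
  case (Cons s w)
  let ?N = "foldr (flip A) w {}"
  have "w \<in> lists S"
    using Cons.prems by auto
  then have c: "s \<in> carrier G" "val w \<in> carrier G" "?N \<subseteq> carrier G"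
    using Cons.prems S_carrier foldr_flip_carrier by auto
  then have c': "conjugate (val w) ` U \<subseteq> carrier G"
    using assms(2) by auto
  have "conjugate s ` foldr (flip A) w U = sym_diff (conjugate s ` ?N) (conjugate s ` conjugate (val w) ` U)"
    using Cons c c' by (simp add: image_sym_diff [OF conjugate_inj])
  also have "conjugate s ` conjugate (val w) ` U = conjugate (val (s # w)) ` U"
    using c assms by (simp add: conjugate_image_mult)
  finally have "foldr (flip A) (s # w) U = sym_diff (if s \<in> A then {s} else {})
      (sym_diff (conjugate s ` ?N) (conjugate (val (s # w)) ` U))"
    by (simp only: foldr_Cons comp_apply flip_def [of A s])
  also have "\<dots> = sym_diff (foldr (flip A) (s # w) {}) (conjugate (val (s # w)) ` U)"
    by (simp only: foldr_Cons comp_apply flip_def [of A s] sym_diff_assoc)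
  finally show ?case .
qed

text \<open>\<open>inversions A\<close> is the cocycle with \<open>s \<mapsto> {s}\<close> for \<open>s \<in> A\<close> and \<open>s \<mapsto> {}\<close> for other generators.\<close>

lemma inversions_mult:
  assumes "g \<in> carrier G" "h \<in> carrier G"
  shows "inversions A (g \<otimes> h) = sym_diff (inversions A g) (conjugate g ` inversions A h)"
proof -
  obtain u v where uv: "u \<in> lists S" "val u = g" "v \<in> lists S" "val v = h"
    using assms val_surj by metis
  then have "inversions A (g \<otimes> h) = foldr (flip A) u (foldr (flip A) v {})"
    using inversions_val [of "u @ v" A] by simp
  also have "\<dots> = sym_diff (foldr (flip A) u {}) (conjugate g ` foldr (flip A) v {})"
    using foldr_flip [of u "foldr (flip A) v {}" A] uv foldr_flip_carrier [of v "{}" A] by blast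
  finally show ?thesis
    using inversions_val [OF uv(1), of A] inversions_val [OF uv(3), of A] uv by simp
qed

lemma inversions_one [simp]: "inversions A \<one> = {}"
  using inversions_val [of "[]" A] by simp

lemma inversions_gen: "s \<in> S \<Longrightarrow> inversions A s = (if s \<in> A then {s} else {})"
  using inversions_val [of "[s]" A] S_carrier by (simp add: flip_empty)

lemma inversions_mult_gen:
  assumes "g \<in> carrier G" "s \<in> S"
  shows "inversions A (g \<otimes> s) = sym_diff (inversions A g) (if s \<in> A then {conjugate g s} else {})"
  using assms S_carrier by (simp add: inversions_mult inversions_gen)

lemma inversions_gen_diff:
  assumes "g \<in> carrier G" "s \<in> S" "s \<in> A"
  shows "sym_diff (inversions A g) (inversions A (g \<otimes> s)) = {conjugate g s}"
  by (simp only: inversions_mult_gen assms if_True sym_diff_sym_diff)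

text \<open>By the cocycle rule both inversion sets contain the summand
  \<open>inversions A g\<close>, which cancels.\<close>

lemma inversions_translate:
  assumes "g \<in> carrier G" "x \<in> carrier G" "y \<in> carrier G"
  shows "sym_diff (inversions A (g \<otimes> x)) (inversions A (g \<otimes> y))
    = conjugate g ` sym_diff (inversions A x) (inversions A y)"
proof -
  have "conjugate g ` sym_diff (inversions A x) (inversions A y)
      = sym_diff (conjugate g ` inversions A x) (conjugate g ` inversions A y)"
    using assms inversions_carrier by (intro image_sym_diff [OF conjugate_inj]) auto
  then show ?thesis
    by (simp only: inversions_mult assms sym_diff_cancel_left)
qed

lemma card_inversions_diff:
  assumes "g \<in> carrier G" "h \<in> carrier G"
  shows "card (sym_diff (inversions A g) (inversions A h)) = card (inversions A (inv g \<otimes> h))"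
proof -
  let ?k = "inv g \<otimes> h"
  have k: "?k \<in> carrier G" "g \<otimes> ?k = h"
    using assms by (auto simp flip: m_assoc)
  have "sym_diff (inversions A (g \<otimes> \<one>)) (inversions A (g \<otimes> ?k))
      = conjugate g ` sym_diff (inversions A \<one>) (inversions A ?k)"
    using assms k by (intro inversions_translate) auto
  then have "sym_diff (inversions A g) (inversions A h) = conjugate g ` inversions A ?k"
    using assms k by simp
  moreover have "inj_on (conjugate g) (inversions A ?k)"
    using conjugate_inj inversions_carrier assms k by (meson inj_on_subset)
  ultimately show ?thesis
    by (simp add: card_image)
qed

text \<open>The walls of type \<open>A\<close> crossed by the path labelled \<open>w\<close> starting at \<open>\<one>\<close>, with repetitions.\<close>

fun crossed :: "'a set \<Rightarrow> 'a list \<Rightarrow> 'a list"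
  where
    "crossed A [] = []"
  | "crossed A (s # w) = (if s \<in> A then [s] else []) @ map (conjugate s) (crossed A w)"

lemma length_crossed: "length (crossed A w) = length (filter (\<lambda>s. s \<in> A) w)"
  by (induction w) auto

lemma crossed_carrier: "w \<in> lists S \<Longrightarrow> set (crossed A w) \<subseteq> carrier G"
  by (induction w) (auto simp: S_carrier)

lemma crossed_mono: "A \<subseteq> B \<Longrightarrow> set (crossed A w) \<subseteq> set (crossed B w)"
  by (induction w) auto

lemma distinct_map_conj:
  assumes "s \<in> S" "w \<in> lists S"
  shows "distinct (map (conjugate s) (crossed A w)) \<longleftrightarrow> distinct (crossed A w)"
  using assms crossed_carrier conjugate_inj S_carrier by (metis distinct_map inj_on_subset)

lemma distinct_crossed_mono:
  assumes "A \<subseteq> B" "w \<in> lists S" "distinct (crossed B w)"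
  shows "distinct (crossed A w)"
  using assms(2,3)
proof (induction w rule: list.induct)
  case (Cons s w)
  then have "distinct (crossed B w)"
    by (simp add: distinct_map_conj)
  with Cons show ?case
    using crossed_mono [OF assms(1), of w] assms(1)
    by (cases "s \<in> A") (auto simp: distinct_map_conj subsetD)
qed simp

lemma foldr_flip_subset_crossed: "foldr (flip A) w {} \<subseteq> set (crossed A w)"
  by (induction w) (auto simp: flip_def)

text \<open>The symmetric differences lose a wall only when it is crossed again.\<close>

lemma foldr_flip_distinct:
  assumes "w \<in> lists S" "distinct (crossed A w)"
  shows "foldr (flip A) w {} = set (crossed A w)"
  using assms
proof (induction w rule: list.induct)
  case (Cons s w)
  then have "distinct (crossed A w)"
    by (simp add: distinct_map_conj)
  with Cons show ?case
    by (auto simp: flip_def)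
qed simp

lemma crossedE:
  assumes "r \<in> set (crossed A w)" "w \<in> lists S"
  obtains v b z where "w = v @ b # z" "b \<in> A" "r = conjugate (val v) b"
proof -
  have "\<exists>v b z. w = v @ b # z \<and> b \<in> A \<and> r = conjugate (val v) b"
    using assms
  proof (induction w arbitrary: r rule: list.induct)
    case (Cons s w)
    show ?case
    proof (cases "s \<in> A \<and> r = s")
      case True
      then have "s # w = [] @ s # w \<and> s \<in> A \<and> r = conjugate (val []) s"
        using Cons.prems S_carrier by simp
      then show ?thesis by blast
    next
      case False
      with Cons.prems obtain r' where r': "r' \<in> set (crossed A w)" "r = conjugate s r'"
        by (auto split: if_splits)
      have "\<exists>v b z. w = v @ b # z \<and> b \<in> A \<and> r' = conjugate (val v) b"
        using Cons.IH [OF r'(1)] Cons.prems by auto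
      then obtain v b z where "w = v @ b # z" "b \<in> A" "r' = conjugate (val v) b"
        by blast
      moreover from this have "r = conjugate (val (s # v)) b"
        using r' Cons.prems S_carrier by (auto simp: conjugate_mult)
      ultimately show ?thesis
        by (metis append_Cons)
    qed
  qed simp
  then show ?thesis
    using that by blast
qed

text \<open>The reflection in the wall crossed at the letter \<open>b\<close> cancels the prefix
  \<open>v\<close> and then \<open>b\<close> against itself, so multiplying by it deletes this
  letter.\<close>

lemma conjugate_val_delete:
  assumes "v \<in> lists S" "b \<in> S" "z \<in> lists S"
  shows "conjugate (val v) b \<otimes> val (v @ b # z) = val (v @ z)"
proof -
  have "inv (val v) \<otimes> (val v \<otimes> x) = x" if "x \<in> carrier G" for x
    using that assms by (simp flip: m_assoc)
  then show ?thesis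
    using assms by (simp add: conjugate_def m_assoc S_carrier S_cancel)
qed

text \<open>The deletion condition of Coxeter groups: a path crossing a wall twice is shortened by
  reflecting the part in between.\<close>

lemma deletion:
  assumes "w \<in> lists S" "\<not> distinct (crossed A w)"
  obtains w' where "w' \<in> lists S" "val w' = val w" "length w' < length w"
proof -
  have "\<exists>w'\<in>lists S. val w' = val w \<and> length w' < length w"
    using assms
  proof (induction w rule: list.induct)
    case (Cons s w)
    show ?case
    proof (cases "distinct (crossed A w)")
      case True
      have s: "s \<in> S" "s \<in> carrier G" and w: "w \<in> lists S"
        using Cons.prems S_carrier by auto
      \<comment> \<open>The tail crosses no wall twice, so the repeated wall is that of the first
        letter.\<close>
      from True Cons.prems have "s \<in> conjugate s ` set (crossed A w)"
        using distinct_map_conj [OF s(1) w] by (auto split: if_splits)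
      then obtain r where r: "r \<in> set (crossed A w)" "s = conjugate s r"
        by auto
      have "r \<in> carrier G"
        using r crossed_carrier w by auto
      then have "r = s"
        using r s conjugate_self conjugate_inj [OF s(2)] by (metis inj_onD)
      with r w obtain v b z where vbz: "w = v @ b # z" "s = conjugate (val v) b"
        by (metis crossedE)
      with w have "v \<in> lists S" "b \<in> S" "z \<in> lists S"
        by auto
      \<comment> \<open>Multiplying \<open>val w\<close> by the reflection \<open>s\<close> deletes
        \<open>b\<close>, so \<open>s # w\<close> loses both \<open>s\<close> and
        \<open>b\<close>.\<close>
      with vbz have "val (s # w) = val (v @ z)"
        using conjugate_val_delete by simp
      then show ?thesis
        using vbz w by (intro bexI [of _ "v @ z"]) auto
    next
      case False
      with Cons obtain w' where "w' \<in> lists S" "val w' = val w" "length w' < length w"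
        by auto
      then show ?thesis
        using Cons.prems by (intro bexI [of _ "s # w'"]) auto
    qed
  qed simp
  then show ?thesis
    using that by blast
qed

text \<open>A word of minimal length is distinct for all walls by \<open>deletion\<close>, hence for
  the walls of each type \<open>A\<close>. Having one word for all types is what allows the
  distances in the trees to be added up.\<close>

lemma reduced_word:
  assumes "g \<in> carrier G"
  obtains w where "w \<in> lists S" "val w = g" "\<And>A. A \<subseteq> S \<Longrightarrow> distinct (crossed A w)"
proof -
  obtain w where w: "w \<in> lists S \<and> val w = g"
    and min: "\<forall>v. v \<in> lists S \<and> val v = g \<longrightarrow> length w \<le> length v"
    using ex_has_least_nat [of "\<lambda>w. w \<in> lists S \<and> val w = g" _ length] val_surj [OF assms]
    by metis
  have "distinct (crossed S w)"
    using deletion [of w S] w min by (metis not_le)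
  then show ?thesis
    using that w distinct_crossed_mono by blast
qed

lemma inversions_distinct:
  assumes "w \<in> lists S" "distinct (crossed A w)"
  shows "inversions A (val w) = set (crossed A w)"
  using assms foldr_flip_distinct inversions_val by simp

lemma card_inversions_distinct:
  assumes "w \<in> lists S" "distinct (crossed A w)"
  shows "card (inversions A (val w)) = length (filter (\<lambda>s. s \<in> A) w)"
  using assms by (simp add: inversions_distinct distinct_card length_crossed)

lemma inversions_subset_crossed:
  "w \<in> lists S \<Longrightarrow> inversions A (val w) \<subseteq> set (crossed A w)"
  using foldr_flip_subset_crossed inversions_val by simp

subsection \<open>Centralizers of generators\<close>

text \<open>The parity of the number of letters \<open>s\<close> is a homomorphism to a group of
  order two, so it agrees on conjugate elements; it separates \<open>s\<close> from all other
  generators.\<close>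

lemma conjugate_generators:
  assumes "s \<in> S" "t \<in> S" "g \<in> carrier G" "g \<otimes> s = t \<otimes> g"
  shows "s = t"
proof (rule ccontr)
  assume "s \<noteq> t"
  obtain w where w: "w \<in> lists S" "val w = g"
    using assms val_surj by blast
  let ?F = "\<lambda>a b. if a = s then \<not> b else b"
  have "val (w @ [s]) = val (t # w)"
    using w assms S_carrier by simp
  then have "foldr ?F (w @ [s]) False = foldr ?F (t # w) False"
    using w assms by (intro foldr_cong_val [where M = UNIV]) auto
  moreover have "foldr ?F w True = (\<not> foldr ?F w False)"
    by (induction w) auto
  ultimately show False
    using \<open>s \<noteq> t\<close> by auto
qed

text \<open>Ping-pong: if \<open>s\<close> and \<open>t\<close> do not commute, the reflections \<open>y \<mapsto> -y\<close> and \<open>y \<mapsto> 4 - y\<close> of the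
  integers define an action of the group in which all other generators act trivially.\<close>

lemma alternating_not_inversion:
  assumes "s \<in> S" "t \<in> S" "s \<otimes> t \<noteq> t \<otimes> s"
    and "u \<in> lists {s, t}" "distinct_adj u" "u \<noteq> []" "hd u = s"
  shows "t \<notin> inversions A (val u)"
proof
  have ne: "s \<noteq> t"
    using assms by auto
  define F :: "'a \<Rightarrow> int \<Rightarrow> int"
    where "F = (\<lambda>a y. if a = s then - y else if a = t then 4 - y else y)"
  \<comment> \<open>The two reflections do not commute, but neither do \<open>s\<close> and
    \<open>t\<close>; all other pairs of maps commute.\<close>
  have F_cong: "foldr F v 1 = foldr F w 1"
    if "v \<in> lists S" "w \<in> lists S" "val v = val w" for v w
    using that assms(1-3) by (intro foldr_cong_val [where M = UNIV]) (auto simp: F_def)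
  \<comment> \<open>The point 1 lies between the fixed points 0 and 2; the first letter of an
    alternating word is applied last and decides on which side the image ends.\<close>
  have pingpong: "(v = [] \<longrightarrow> foldr F v 1 = 1) \<and> (v \<noteq> [] \<and> hd v = s \<longrightarrow> foldr F v 1 < 0) \<and>
      (v \<noteq> [] \<and> hd v = t \<longrightarrow> foldr F v 1 > 2)" if "v \<in> lists {s, t}" "distinct_adj v" for v
    using that
  proof (induction v)
    case (Cons a v)
    then show ?case
      using ne by (cases v) (auto simp: F_def)
  qed simp
  have uS: "u \<in> lists S"
    using assms by auto
  assume "t \<in> inversions A (val u)"
  then obtain v b z where vbz: "u = v @ b # z" "t = conjugate (val v) b"
    using inversions_subset_crossed uS crossedE by (metis subsetD)
  have S: "v \<in> lists S" "b \<in> S" "v \<in> lists {s, t}" "b \<in> {s, t}"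
    using uS assms(4) vbz by auto
  have "v \<noteq> []"
    using vbz S assms(7) ne S_carrier by auto
  then have hd: "hd v = s"
    using vbz assms(7) by simp
  have "val v \<otimes> b = t \<otimes> val v"
    using vbz(2) S assms S_carrier conjugate_eq_iff by (metis val_carrier)
  then have "val (v @ [b]) = val (t # v)"
    using S S_carrier by simp
  \<comment> \<open>Both words are alternating, but one begins with \<open>s\<close> and the other
    with \<open>t\<close>, so this common image would be both below 0 and above 2.\<close>
  then have "foldr F (v @ [b]) 1 = foldr F (t # v) 1"
    using S assms by (intro F_cong) auto
  moreover have "distinct_adj (v @ [b])" "distinct_adj v"
    using assms(5) vbz(1) by (auto simp: distinct_adj_append_iff)
  moreover from this have "distinct_adj (t # v)"
    using hd ne \<open>v \<noteq> []\<close> by (cases v) auto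
  ultimately show False
    using pingpong [of "v @ [b]"] pingpong [of "t # v"] S hd \<open>v \<noteq> []\<close> by auto
qed

text \<open>Choose \<open>x = u w\<close> with \<open>u\<close> in the dihedral subgroup \<open>\<langle>s, t\<rangle>\<close> and \<open>w\<close> as short as possible. Then no
  inversion of \<open>w\<close> lies in \<open>\<langle>s, t\<rangle>\<close>, so \<open>s\<close> and \<open>t\<close> are inversions of \<open>u\<close>.\<close>

lemma inversions_commute:
  assumes st: "s \<in> S" "t \<in> S" and x: "x \<in> carrier G"
    and inv: "s \<in> inversions A x" "t \<in> inversions A x"
  shows "s \<otimes> t = t \<otimes> s"
proof (rule ccontr)
  assume nc: "s \<otimes> t \<noteq> t \<otimes> s"
  define P where "P = (\<lambda>u w. u \<in> lists {s, t} \<and> w \<in> lists S \<and> val u \<otimes> val w = x)"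
  have "\<exists>w. P [] w"
    unfolding P_def using val_surj [OF x] by (metis lists.Nil val_Nil l_one val_carrier)
  then obtain w where w: "\<exists>u. P u w" and w_min: "\<And>u w'. P u w' \<Longrightarrow> length w \<le> length w'"
    using ex_has_least_nat [of "\<lambda>w. \<exists>u. P u w" _ length] by metis
  \<comment> \<open>For this \<open>w\<close> a shortest \<open>u\<close> is taken; it is
    alternating, as \<open>alternating_not_inversion\<close> requires.\<close>
  then obtain u where u: "P u w" and u_min: "\<And>u'. P u' w \<Longrightarrow> length u \<le> length u'"
    using ex_has_least_nat [of "\<lambda>u. P u w" _ length] by metis
  have D: "e \<in> lists S" if "e \<in> lists {s, t}" for e
    using that st by auto
  have uw: "u \<in> lists {s, t}" "u \<in> lists S" "w \<in> lists S" "x = val u \<otimes> val w"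
    using u D unfolding P_def by auto
  have "distinct_adj u"
  proof (rule ccontr)
    assume "\<not> distinct_adj u"
    then obtain p a q where paq: "u = p @ a # a # q"
      by (rule not_distinct_adjE)
    with uw have "p \<in> lists S" "a \<in> S" "q \<in> lists S"
      by auto
    then have "val (p @ q) = val u"
      using S_cancel paq by simp
    then have "P (p @ q) w"
      using u paq unfolding P_def by auto
    from u_min [OF this] show False
      using paq by simp
  qed
  \<comment> \<open>Otherwise multiplication by this element of the dihedral subgroup deletes a
    letter of \<open>w\<close>, and its inverse is absorbed into \<open>u\<close>, against the
    minimality of \<open>w\<close>.\<close>
  have w_inv: "val e \<notin> inversions A (val w)" if e: "e \<in> lists {s, t}" for e
  proof
    assume "val e \<in> inversions A (val w)"
    then obtain v b z where vbz: "w = v @ b # z" "val e = conjugate (val v) b"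
      using inversions_subset_crossed uw crossedE by (metis subsetD)
    with uw have S: "v \<in> lists S" "b \<in> S" "z \<in> lists S"
      by auto
    have "rev e \<in> lists {s, t}"
      using e by auto
    then have eS: "e \<in> lists S" "rev e \<in> lists S" "rev e \<in> lists {s, t}"
      using e D by blast+
    have "val e \<otimes> val w = val (v @ z)"
      using conjugate_val_delete S vbz by simp
    then have "val w = val (rev e) \<otimes> val (v @ z)"
      using eS S uw(3) by (metis append_in_lists_conv inv_solve_left val_carrier val_rev)
    then have "P (u @ rev e) (v @ z)"
      using uw eS S unfolding P_def by (simp add: m_assoc)
    from w_min [OF this] show False
      using vbz by simp
  qed
  \<comment> \<open>An inversion \<open>a\<close> of \<open>x\<close> that \<open>u\<close> lacks
    comes from an inversion of \<open>w\<close>, namely \<open>a\<close> conjugated by the inverse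
    of \<open>val u\<close>; this again lies in the dihedral subgroup.\<close>
  have u_inv: "a \<in> inversions A (val u)" if a: "a \<in> {s, t}" "a \<in> inversions A x" for a
  proof (rule ccontr)
    assume "a \<notin> inversions A (val u)"
    with a uw have "a \<in> conjugate (val u) ` inversions A (val w)"
      by (auto simp: inversions_mult)
    then obtain r where r: "r \<in> inversions A (val w)" "a = conjugate (val u) r"
      by auto
    have "r \<in> carrier G"
      using r uw inversions_carrier by blast
    moreover have a': "a \<in> carrier G" "a \<in> S" "rev u \<in> lists S"
      using a st S_carrier uw(2) by auto
    moreover have "val u \<otimes> r = a \<otimes> val u"
      using r(2) a' uw(2) \<open>r \<in> carrier G\<close> by (metis conjugate_eq_iff val_carrier)
    ultimately have "val (rev u @ a # u) = inv (val u) \<otimes> (val u \<otimes> r)"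
      using uw(2) by (simp add: val_rev)
    then have "r = val (rev u @ a # u)"
      using \<open>r \<in> carrier G\<close> uw(2) by (simp flip: m_assoc)
    moreover have "rev u @ a # u \<in> lists {s, t}"
      using uw(1) a(1) by (auto simp: in_lists_conv_set)
    ultimately show False
      using w_inv r(1) by metis
  qed
  have "u \<noteq> []"
    using u_inv [of s] inv by auto
  then have "hd u = s \<or> hd u = t"
    using uw(1) by (cases u) auto
  then show False
  proof
    assume "hd u = s"
    then show False
      using alternating_not_inversion [OF st nc uw(1)] u_inv inv \<open>distinct_adj u\<close> \<open>u \<noteq> []\<close>
      by blast
  next
    assume "hd u = t"
    moreover have "u \<in> lists {t, s}" "t \<otimes> s \<noteq> s \<otimes> t"
      using uw(1) nc by (simp_all add: insert_commute)
    ultimately show False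
      using alternating_not_inversion [OF st(2,1)] u_inv inv \<open>distinct_adj u\<close> \<open>u \<noteq> []\<close>
      by blast
  qed
qed

text \<open>Since \<open>val w\<close> fixes the wall of \<open>s\<close> without crossing it,
  \<open>val w \<otimes> s\<close> has \<open>s\<close> as an inversion and keeps those of
  \<open>val w\<close>, among them the first letter of \<open>w\<close>. So the two commute by
  \<open>inversions_commute\<close>, and the tail inherits the hypotheses.\<close>

lemma centralizer_word:
  assumes "s \<in> S" "w \<in> lists S" "distinct (crossed S w)"
    and "val w \<otimes> s = s \<otimes> val w" "s \<notin> inversions S (val w)"
  shows "\<forall>t\<in>set w. t \<noteq> s \<and> s \<otimes> t = t \<otimes> s"
  using assms(2-)
proof (induction w rule: list.induct)
  case (Cons t w)
  let ?x = "val (t # w)"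
  have S: "t \<in> S" "w \<in> lists S" "t \<in> carrier G" "s \<in> carrier G" "val w \<in> carrier G"
    "?x \<in> carrier G"
    using Cons.prems assms(1) S_carrier by auto
  have t: "t \<in> inversions S ?x"
    using Cons.prems S inversions_distinct [of "t # w" S] by auto
  with Cons.prems have ne: "t \<noteq> s"
    by auto
  have "conjugate ?x s = s"
    using Cons.prems S by (intro conjugate_commute) auto
  then have "inversions S (?x \<otimes> s) = insert s (inversions S ?x)"
    using Cons.prems assms(1) S inversions_mult_gen [of ?x s S] by auto
  then have st: "s \<otimes> t = t \<otimes> s"
    using t S assms(1) inversions_commute [of s t "?x \<otimes> s" S] by auto
  have "t \<otimes> (val w \<otimes> s) = t \<otimes> (s \<otimes> val w)"
    using Cons.prems S st by (simp flip: m_assoc)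
  then have "val w \<otimes> s = s \<otimes> val w"
    using S by simp
  moreover have "s \<notin> inversions S (val w)"
  proof
    assume "s \<in> inversions S (val w)"
    moreover have "conjugate t s = s"
      using S st by (simp add: conjugate_commute)
    ultimately have "s \<in> conjugate t ` inversions S (val w)"
      by force
    then have "s \<in> inversions S ?x"
      using S ne by (simp add: inversions_mult inversions_gen)
    then show False
      using Cons.prems by simp
  qed
  moreover have "distinct (crossed S w)"
    using Cons.prems S distinct_map_conj by simp
  ultimately show ?case
    using Cons.IH S ne st by auto
qed simp

definition independent :: "'a set \<Rightarrow> bool"
  where "independent A \<longleftrightarrow> A \<subseteq> S \<and> (\<forall>s\<in>A. \<forall>t\<in>A. s \<otimes> t = t \<otimes> s \<longrightarrow> s = t)"

text \<open>All letters of a reduced word of \<open>x\<close> commute with \<open>s\<close> and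
  differ from it, so by independence none lies in \<open>A\<close>.\<close>

lemma inversions_centralizer_aux:
  assumes "independent A" "s \<in> A" "x \<in> carrier G" "x \<otimes> s = s \<otimes> x" "s \<notin> inversions S x"
  shows "inversions A x = {}"
proof -
  have s: "s \<in> S" and A: "A \<subseteq> S"
    using assms unfolding independent_def by auto
  obtain w where w: "w \<in> lists S" "val w = x" "\<And>A. A \<subseteq> S \<Longrightarrow> distinct (crossed A w)"
    using reduced_word [OF assms(3)] by blast
  then have "\<forall>t\<in>set w. t \<noteq> s \<and> s \<otimes> t = t \<otimes> s"
    using centralizer_word [OF s w(1) w(3) [OF order_refl]] assms(4,5) by simp
  then have "\<forall>t\<in>set w. t \<notin> A"
    using assms(1,2) unfolding independent_def by blast
  then have "crossed A w = []"
    using length_crossed [of A w] by simp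
  then show ?thesis
    using inversions_distinct [of w A] w A by simp
qed

text \<open>If \<open>x\<close> crosses the wall of \<open>s\<close>, then
  \<open>x \<otimes> s\<close> does not and still centralizes \<open>s\<close>; this reduces to the
  previous case at the cost of the single wall \<open>s\<close>.\<close>

lemma inversions_centralizer:
  assumes "independent A" "s \<in> A" "x \<in> carrier G" "x \<otimes> s = s \<otimes> x"
  shows "inversions A x \<subseteq> {s}"
proof (cases "s \<in> inversions S x")
  case True
  have s: "s \<in> S" "s \<in> carrier G"
    using assms S_carrier unfolding independent_def by auto
  have conjugate: "conjugate x s = s"
    using assms s by (simp add: conjugate_commute)
  have "s \<notin> inversions S (x \<otimes> s)"
    using True conjugate inversions_mult_gen [OF assms(3) s(1), of S] s(1) by simp
  moreover have "(x \<otimes> s) \<otimes> s = s \<otimes> (x \<otimes> s)"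
    using assms s by (metis m_assoc)
  ultimately have "inversions A (x \<otimes> s) = {}"
    using assms s by (intro inversions_centralizer_aux [of A s]) auto
  then show ?thesis
    using inversions_mult_gen [OF assms(3) s(1), of A] conjugate assms(2) by auto
qed (use assms inversions_centralizer_aux in auto)

subsection \<open>The tree of an independent set of generators\<close>

definition chamber :: "'a set \<Rightarrow> 'a \<Rightarrow> 'a set"
  where "chamber A g = {x \<in> carrier G. inversions A x = inversions A g}"

definition chambers :: "'a set \<Rightarrow> 'a set set"
  where "chambers A = chamber A ` carrier G"

definition panels :: "'a set \<Rightarrow> 'a set set set"
  where "panels A = {{chamber A g, chamber A (g \<otimes> s)} | g s. g \<in> carrier G \<and> s \<in> A}"

text \<open>Elements of a chamber share their inversions, so on chambers the choice is immaterial.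
  This is the potential for distances in the tree.\<close>

definition inversions_of :: "'a set \<Rightarrow> 'a set \<Rightarrow> 'a set"
  where "inversions_of A U = inversions A (SOME x. x \<in> U)"

lemma chamber_eq_iff:
  assumes "g \<in> carrier G" "h \<in> carrier G"
  shows "chamber A g = chamber A h \<longleftrightarrow> inversions A g = inversions A h"
  using assms unfolding chamber_def by auto

lemma inversions_of_chamber [simp]:
  assumes "g \<in> carrier G"
  shows "inversions_of A (chamber A g) = inversions A g"
proof -
  have "(SOME x. x \<in> chamber A g) \<in> chamber A g"
    by (rule someI [of _ g]) (use assms in \<open>simp add: chamber_def\<close>)
  then show ?thesis
    unfolding inversions_of_def by (simp add: chamber_def)
qed

lemma panelE:
  assumes "{U, T} \<in> panels A" "A \<subseteq> S"
  obtains g s where "g \<in> carrier G" "s \<in> A" "{U, T} = {chamber A g, chamber A (g \<otimes> s)}"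
    "sym_diff (inversions_of A U) (inversions_of A T) = {conjugate g s}"
proof -
  obtain g s where gs: "g \<in> carrier G" "s \<in> A" "{U, T} = {chamber A g, chamber A (g \<otimes> s)}"
    using assms unfolding panels_def by auto
  have s: "s \<in> S" "s \<in> carrier G"
    using gs assms S_carrier by auto
  have diff: "sym_diff (inversions A g) (inversions A (g \<otimes> s)) = {conjugate g s}"
    using gs s inversions_gen_diff by simp
  consider "U = chamber A g" "T = chamber A (g \<otimes> s)" | "T = chamber A g" "U = chamber A (g \<otimes> s)"
    using gs(3) by (auto simp: doubleton_eq_iff)
  then have "sym_diff (inversions_of A U) (inversions_of A T) = {conjugate g s}"
    using diff gs(1) s(2) by cases (simp_all add: Un_commute)
  with gs that show ?thesis by blast
qed

lemma panel_diff:
  assumes "{U, T} \<in> panels A" "A \<subseteq> S"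
  shows "\<exists>r. sym_diff (inversions_of A U) (inversions_of A T) = {r}"
  using panelE [OF assms] by metis

text \<open>This is where independence matters: walls of type \<open>A\<close> do not cross, so each of them is
  crossed by a single panel.\<close>

lemma panel_determined_by_wall:
  assumes A: "independent A" and "g \<in> carrier G" "h \<in> carrier G" "s \<in> A" "t \<in> A"
    and eq: "conjugate g s = conjugate h t"
  shows "{chamber A g, chamber A (g \<otimes> s)} = {chamber A h, chamber A (h \<otimes> t)}"
proof -
  have s: "s \<in> S" "s \<in> carrier G" and t: "t \<in> S" "t \<in> carrier G"
    using assms S_carrier unfolding independent_def by auto
  \<comment> \<open>The element relating the two panels; it turns out to centralize
    \<open>s\<close>.\<close>
  define x where "x = inv h \<otimes> g"
  have x: "x \<in> carrier G" "g = h \<otimes> x"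
    using assms unfolding x_def by (auto simp flip: m_assoc)
  have "conjugate h (conjugate x s) = conjugate h t"
    using eq x s assms by (simp add: conjugate_mult)
  then have "conjugate x s = t"
    using conjugate_inj [of h] assms x s t by (metis conjugate_carrier inj_onD)
  then have "x \<otimes> s = t \<otimes> x"
    using x s t by (simp add: conjugate_eq_iff)
  moreover from this have "s = t"
    using conjugate_generators s t x by blast
  ultimately have "inversions A x \<subseteq> {s}"
    using inversions_centralizer assms x by blast
  \<comment> \<open>So \<open>g\<close> lies in the chamber of \<open>h\<close> or in that of
    \<open>h \<otimes> s\<close>, on either side of the common wall.\<close>
  then have "inversions A g = inversions A h \<or>
      inversions A g = sym_diff (inversions A h) {conjugate h s}"
    using x assms inversions_mult [of h x A] by (auto simp: subset_singleton_iff)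
  then have "{inversions A g, inversions A (g \<otimes> s)} = {inversions A h, inversions A (h \<otimes> s)}"
    using eq \<open>s = t\<close> assms s by (auto simp: inversions_mult_gen)
  then show ?thesis
    using \<open>s = t\<close> assms s by (auto simp: doubleton_eq_iff chamber_eq_iff)
qed

text \<open>A letter outside \<open>A\<close> does not leave the chamber, so only the letters in
  \<open>A\<close> contribute steps.\<close>

lemma chamber_walk:
  assumes "A \<subseteq> S" "w \<in> lists S" "g \<in> carrier G"
  shows "\<exists>p. graph_walk (chambers A) (panels A) p \<and> hd p = chamber A g \<and>
    last p = chamber A (g \<otimes> val w) \<and> length p = Suc (length (filter (\<lambda>s. s \<in> A) w))"
  using assms(2,3)
proof (induction w arbitrary: g rule: list.induct)
  case Nil
  then show ?case
    by (intro exI [of _ "[chamber A g]"]) (auto simp: graph_walk_Cons chambers_def)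
next
  case (Cons s w)
  have s: "s \<in> S" "s \<in> carrier G" "g \<otimes> s \<in> carrier G"
    using Cons.prems S_carrier by auto
  obtain p where p: "graph_walk (chambers A) (panels A) p" "hd p = chamber A (g \<otimes> s)"
      "last p = chamber A (g \<otimes> s \<otimes> val w)"
      "length p = Suc (length (filter (\<lambda>s. s \<in> A) w))"
    using Cons.IH [OF _ s(3)] Cons.prems by auto
  have "p \<noteq> []"
    using p by auto
  show ?case
  proof (cases "s \<in> A")
    case True
    then have "{chamber A g, hd p} \<in> panels A"
      using p Cons.prems unfolding panels_def by auto
    then show ?thesis
      using p True Cons.prems \<open>p \<noteq> []\<close> s
      by (intro exI [of _ "chamber A g # p"])
        (auto simp: graph_walk_Cons chambers_def m_assoc)
  next
    case False
    then have "chamber A (g \<otimes> s) = chamber A g"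
      using Cons.prems s by (simp add: chamber_eq_iff inversions_mult_gen)
    then show ?thesis
      using p False Cons.prems s by (intro exI [of _ p]) (auto simp: m_assoc)
  qed
qed

text \<open>The walk along a reduced word attains the lower bound given by the potential
  \<open>inversions_of A\<close>.\<close>

lemma chamber_graph_dist:
  assumes "A \<subseteq> S" "g \<in> carrier G" "h \<in> carrier G"
  shows "graph_dist (chambers A) (panels A) (chamber A g) (chamber A h)
    = card (inversions A (inv g \<otimes> h))"
proof -
  obtain w where w: "w \<in> lists S" "val w = inv g \<otimes> h" "\<And>A. A \<subseteq> S \<Longrightarrow> distinct (crossed A w)"
    using reduced_word [of "inv g \<otimes> h"] assms by auto
  have h: "g \<otimes> val w = h"
    using assms w by (simp flip: m_assoc)
  have card: "card (inversions A (inv g \<otimes> h)) = length (filter (\<lambda>s. s \<in> A) w)"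
    using card_inversions_distinct w assms by metis
  obtain p where p: "graph_walk (chambers A) (panels A) p" "hd p = chamber A g"
      "last p = chamber A h" "length p = Suc (length (filter (\<lambda>s. s \<in> A) w))"
    using chamber_walk [OF assms(1) w(1) assms(2)] h by metis
  let ?M = "inversions_of A"
  have "graph_dist (chambers A) (panels A) (chamber A g) (chamber A h)
      = card (sym_diff (?M (chamber A g)) (?M (chamber A h)))"
    using p card assms card_inversions_diff panel_diff
    by (intro graph_dist_eq_card [of _ _ p]) auto
  then show ?thesis
    using assms card_inversions_diff by simp
qed

lemma cayley_walk:
  assumes "w \<in> lists S" "g \<in> carrier G"
  shows "\<exists>p. graph_walk (carrier G) (cayley_edges G S) p \<and> hd p = g \<and>
    last p = g \<otimes> val w \<and> length p = Suc (length w)"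
  using assms
proof (induction w arbitrary: g rule: list.induct)
  case Nil
  then show ?case
    by (intro exI [of _ "[g]"]) (auto simp: graph_walk_Cons)
next
  case (Cons s w)
  have s: "s \<in> S" "s \<in> carrier G" "g \<otimes> s \<in> carrier G"
    using Cons.prems S_carrier by auto
  obtain p where p: "graph_walk (carrier G) (cayley_edges G S) p" "hd p = g \<otimes> s"
      "last p = g \<otimes> s \<otimes> val w" "length p = Suc (length w)"
    using Cons.IH [OF _ s(3)] Cons.prems by auto
  moreover have "{g, g \<otimes> s} \<in> cayley_edges G S"
    using Cons.prems s unfolding cayley_edges_def by auto
  moreover have "p \<noteq> []"
    using p by auto
  ultimately show ?case
    using Cons.prems s
    by (intro exI [of _ "g # p"]) (auto simp: graph_walk_Cons m_assoc)
qed

lemma cayley_edge_diff: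
  assumes "{x, y} \<in> cayley_edges G S"
  shows "\<exists>r. sym_diff (inversions S x) (inversions S y) = {r}"
proof -
  obtain g s where gs: "g \<in> carrier G" "s \<in> S" "{x, y} = {g, g \<otimes> s}"
    using assms unfolding cayley_edges_def by auto
  then have "sym_diff (inversions S x) (inversions S y) = {conjugate g s}"
    using inversions_gen_diff [OF gs(1,2,2)] by (auto simp only: doubleton_eq_iff Un_commute)
  then show ?thesis by blast
qed

text \<open>The same argument with the potential \<open>inversions S\<close>, for which every letter
  counts.\<close>

lemma cayley_graph_dist:
  assumes "g \<in> carrier G" "h \<in> carrier G" "w \<in> lists S" "val w = inv g \<otimes> h"
    and "distinct (crossed S w)"
  shows "graph_dist (carrier G) (cayley_edges G S) g h = length w"
proof -
  have h: "g \<otimes> val w = h"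
    using assms by (simp flip: m_assoc)
  obtain p where p: "graph_walk (carrier G) (cayley_edges G S) p" "hd p = g"
      "last p = h" "length p = Suc (length w)"
    using cayley_walk [OF assms(3,1)] h by metis
  have "filter (\<lambda>s. s \<in> S) w = w"
    using assms(3) by (auto intro: filter_True)
  then have card: "card (sym_diff (inversions S g) (inversions S h)) = length w"
    using card_inversions_distinct [OF assms(3,5)] assms(1,2,4) card_inversions_diff by simp
  then show ?thesis
    using p cayley_edge_diff graph_dist_eq_card [of _ _ p g h "inversions S"] by metis
qed

text \<open>A cycle must cross the wall of its closing edge a second time, but a wall has only one
  panel.\<close>

lemma chamber_tree:
  assumes A: "independent A"
  shows "simplicial_tree (chambers A) (panels A)"
  unfolding simplicial_tree_def
proof (intro conjI notI)
  have AS: "A \<subseteq> S"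
    using A unfolding independent_def by simp
  show "simple_graph (chambers A) (panels A)"
    unfolding simple_graph_def
  proof (intro ballI)
    fix e assume "e \<in> panels A"
    then obtain g s where gs: "g \<in> carrier G" "s \<in> A" "e = {chamber A g, chamber A (g \<otimes> s)}"
      unfolding panels_def by auto
    have s: "s \<in> S" "s \<in> carrier G"
      using gs AS S_carrier by auto
    then have "chamber A g \<noteq> chamber A (g \<otimes> s)"
      using inversions_gen_diff [OF gs(1) s(1) gs(2)] gs(1) by (auto simp: chamber_eq_iff)
    then show "e \<subseteq> chambers A \<and> card e = 2"
      using gs s unfolding chambers_def by auto
  qed
  show "connected_graph (chambers A) (panels A)"
    unfolding connected_graph_def
  proof (intro conjI ballI)
    show "chambers A \<noteq> {}"
      unfolding chambers_def by auto
    fix U T assume "U \<in> chambers A" "T \<in> chambers A"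
    then obtain g h where gh: "g \<in> carrier G" "h \<in> carrier G" "U = chamber A g" "T = chamber A h"
      unfolding chambers_def by auto
    obtain w where w: "w \<in> lists S" "val w = inv g \<otimes> h"
      using val_surj [of "inv g \<otimes> h"] gh by auto
    then have "g \<otimes> val w = h"
      using gh by (simp flip: m_assoc)
    then show "\<exists>p. graph_walk (chambers A) (panels A) p \<and> hd p = U \<and> last p = T"
      using chamber_walk [OF AS w(1) gh(1)] gh by metis
  qed
  assume "\<exists>p. graph_cycle (chambers A) (panels A) p"
  then obtain p where walk: "graph_walk (chambers A) (panels A) p" and "distinct p"
    and len: "3 \<le> length p" and closing: "{last p, hd p} \<in> panels A"
    unfolding graph_cycle_def by auto
  let ?M = "inversions_of A" and ?k = "length p - 1"
  have "p \<noteq> []"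
    using len by auto
  then have lh: "last p = p ! ?k" "hd p = p ! 0"
    by (simp_all add: last_conv_nth hd_conv_nth)
  obtain g s where gs: "g \<in> carrier G" "s \<in> A"
      "{last p, hd p} = {chamber A g, chamber A (g \<otimes> s)}"
      "sym_diff (?M (last p)) (?M (hd p)) = {conjugate g s}"
    by (rule panelE [OF closing AS])
  define r where "r = conjugate g s"
  \<comment> \<open>The two ends of \<open>p\<close> lie on different sides of the wall
    \<open>r\<close>, so some step along \<open>p\<close> changes sides.\<close>
  have "\<exists>j<?k. (r \<in> ?M (p ! j)) \<noteq> (r \<in> ?M (p ! Suc j))"
  proof (rule ccontr)
    assume *: "\<not> ?thesis"
    have "(r \<in> ?M (p ! j)) = (r \<in> ?M (p ! 0))" if "j \<le> ?k" for j
      using that * by (induction j) auto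
    then have "(r \<in> ?M (last p)) = (r \<in> ?M (hd p))"
      unfolding lh by blast
    moreover have "r \<in> sym_diff (?M (last p)) (?M (hd p))"
      using gs(4) unfolding r_def by simp
    ultimately show False
      by simp
  qed
  then obtain j where j: "j < ?k" "(r \<in> ?M (p ! j)) \<noteq> (r \<in> ?M (p ! Suc j))"
    by blast
  then have "{p ! j, p ! Suc j} \<in> panels A"
    using walk unfolding graph_walk_def by auto
  then obtain h t where ht: "h \<in> carrier G" "t \<in> A"
      "{p ! j, p ! Suc j} = {chamber A h, chamber A (h \<otimes> t)}"
      "sym_diff (?M (p ! j)) (?M (p ! Suc j)) = {conjugate h t}"
    by (rule panelE [OF _ AS])
  have "r \<in> {conjugate h t}"
    using j(2) unfolding ht(4) [symmetric] by simp
  then have "conjugate g s = conjugate h t"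
    unfolding r_def by simp
  then have "{p ! j, p ! Suc j} = {p ! ?k, p ! 0}"
    using panel_determined_by_wall [OF A gs(1) ht(1) gs(2) ht(2)] gs(3) ht(3) lh by simp
  \<comment> \<open>As the vertices of \<open>p\<close> are distinct, equal edges have equal
    indices; the surviving case makes \<open>p\<close> a list of two vertices.\<close>
  then have "j = ?k \<and> Suc j = 0 \<or> j = 0 \<and> Suc j = ?k"
    using \<open>distinct p\<close> \<open>p \<noteq> []\<close> j(1) by (auto simp: doubleton_eq_iff nth_eq_iff_index_eq)
  then show False
    using len by auto
qed

section \<open>The action on the tree\<close>

text \<open>The restriction to chambers makes the map extensional, as membership in
  \<open>Bij\<close> demands.\<close>

definition translate :: "'a set \<Rightarrow> 'a \<Rightarrow> 'a set \<Rightarrow> 'a set"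
  where "translate A g = (\<lambda>U\<in>chambers A. (\<lambda>x. g \<otimes> x) ` U)"

lemma translate_chamber:
  assumes "g \<in> carrier G" "h \<in> carrier G"
  shows "translate A g (chamber A h) = chamber A (g \<otimes> h)"
proof -
  have inv_eq: "inversions A (g \<otimes> x) = inversions A (g \<otimes> y) \<longleftrightarrow> inversions A x = inversions A y"
    if "x \<in> carrier G" "y \<in> carrier G" for x y
    using inversions_translate [OF assms(1) that, of A] by (metis image_is_empty sym_diff_eq_empty)
  have "(\<lambda>x. g \<otimes> x) ` chamber A h = chamber A (g \<otimes> h)"
  proof
    show "(\<lambda>x. g \<otimes> x) ` chamber A h \<subseteq> chamber A (g \<otimes> h)"
      using assms inv_eq by (auto simp: chamber_def)
    show "chamber A (g \<otimes> h) \<subseteq> (\<lambda>x. g \<otimes> x) ` chamber A h"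
    proof
      fix y assume y: "y \<in> chamber A (g \<otimes> h)"
      then have c: "y \<in> carrier G" "inv g \<otimes> y \<in> carrier G" "g \<otimes> (inv g \<otimes> y) = y"
        using assms by (auto simp: chamber_def simp flip: m_assoc)
      then have "inv g \<otimes> y \<in> chamber A h"
        using y assms inv_eq [of "inv g \<otimes> y" h] by (simp add: chamber_def)
      then show "y \<in> (\<lambda>x. g \<otimes> x) ` chamber A h"
        using c by (metis imageI)
    qed
  qed
  then show ?thesis
    using assms unfolding translate_def chambers_def by auto
qed

lemma translate_mult:
  assumes "g \<in> carrier G" "h \<in> carrier G" "U \<in> chambers A"
  shows "translate A (g \<otimes> h) U = translate A g (translate A h U)"
  using assms unfolding chambers_def by (auto simp: translate_chamber m_assoc)

lemma translate_in: "g \<in> carrier G \<Longrightarrow> U \<in> chambers A \<Longrightarrow> translate A g U \<in> chambers A"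
  unfolding chambers_def by (auto simp: translate_chamber)

lemma translate_one: "U \<in> chambers A \<Longrightarrow> translate A \<one> U = U"
  unfolding chambers_def by (auto simp: translate_chamber)

lemma translate_Bij:
  assumes "g \<in> carrier G"
  shows "translate A g \<in> Bij (chambers A)"
proof -
  have "bij_betw (translate A g) (chambers A) (chambers A)"
    using assms translate_in translate_mult [of g "inv g" _ A] translate_mult [of "inv g" g _ A]
    by (intro bij_betw_byWitness [where f' = "translate A (inv g)"]) (auto simp: translate_one)
  then show ?thesis
    unfolding Bij_def translate_def by auto
qed

lemma translate_action:
  assumes "A \<subseteq> S"
  shows "simplicial_action G (chambers A) (panels A) (translate A)"
  unfolding simplicial_action_def
proof (intro conjI ballI)
  have "translate A (g \<otimes> h) = compose (chambers A) (translate A g) (translate A h)"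
    if "g \<in> carrier G" "h \<in> carrier G" for g h
    using that translate_mult
    by (intro extensionalityI [of _ "chambers A"]) (auto simp: translate_def compose_def)
  then have "translate A \<in> hom G (BijGroup (chambers A))"
    by (intro homI) (auto simp: BijGroup_def translate_Bij)
  then show "group_action G (chambers A) (translate A)"
    unfolding group_action_def group_hom_def group_hom_axioms_def
    using group_BijGroup is_group by blast
next
  fix g e assume g: "g \<in> carrier G" and "e \<in> panels A"
  then obtain h s where hs: "h \<in> carrier G" "s \<in> A" "e = {chamber A h, chamber A (h \<otimes> s)}"
    unfolding panels_def by auto
  then have "translate A g ` e = {chamber A (g \<otimes> h), chamber A (g \<otimes> h \<otimes> s)}"
    using g assms S_carrier by (auto simp: translate_chamber m_assoc)
  then show "translate A g ` e \<in> panels A"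
    using g hs unfolding panels_def by blast
qed

subsection \<open>Colourings and the embedding\<close>

text \<open>The \<open>LEAST\<close> in the chromatic number is attained once some colouring exists;
  an injective numbering of the finite set \<open>S\<close> is one.\<close>

lemma colouring_exists: "\<exists>c. colouring G S (chromatic_number G S) c"
proof -
  have "finite S"
    using racg unfolding right_angled_coxeter_group_def by simp
  then obtain c :: "'a \<Rightarrow> nat" where c: "bij_betw c S {1..card S}"
    using finite_same_card_bij [of S "{1..card S}"] by auto
  then have "colouring G S (card S) c"
    unfolding colouring_def by (auto simp: bij_betw_def inj_on_def)
  then show ?thesis
    unfolding chromatic_number_def
    by (intro LeastI [of "\<lambda>n. \<exists>c. colouring G S n c"]) blast
qed

definition colour_class :: "('a \<Rightarrow> nat) \<Rightarrow> nat \<Rightarrow> 'a set"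
  where "colour_class c i = {s \<in> S. c s = i}"

lemma independent_colour_class:
  "colouring G S n c \<Longrightarrow> independent (colour_class c i)"
  unfolding independent_def colour_class_def colouring_def by blast

text \<open>Each letter lies in exactly one of the \<open>n\<close> colour classes.\<close>

lemma sum_colour_class:
  assumes "colouring G S n c" "w \<in> lists S"
  shows "(\<Sum>i\<in>{1..n}. length (filter (\<lambda>s. s \<in> colour_class c i) w)) = length w"
  using assms(2)
proof (induction w rule: list.induct)
  case (Cons s w)
  have cs: "c s \<in> {1..n}" and s: "s \<in> S"
    using assms Cons unfolding colouring_def by auto
  have "(\<Sum>i\<in>{1..n}. length (filter (\<lambda>t. t \<in> colour_class c i) (s # w)))
      = (\<Sum>i\<in>{1..n}. (if i = c s then 1 else 0)
          + length (filter (\<lambda>t. t \<in> colour_class c i) w))"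
    using s by (intro sum.cong) (auto simp: colour_class_def)
  also have "\<dots> = length (s # w)"
    using cs Cons by (simp add: sum.distrib)
  finally show ?case .
qed simp

definition chamber_map :: "nat \<Rightarrow> ('a \<Rightarrow> nat) \<Rightarrow> 'a \<Rightarrow> nat \<Rightarrow> 'a set"
  where "chamber_map n c g = (\<lambda>i\<in>{1..n}. chamber (colour_class c i) g)"

text \<open>A single reduced word computes all distances: its letters of colour \<open>i\<close>
  count the distance in tree \<open>i\<close>, and its length is the distance in the Cayley
  graph.\<close>

lemma chamber_map_isometric:
  assumes c: "colouring G S n c"
  shows "cayley_isometric_embedding G S {1..n} (\<lambda>i. chambers (colour_class c i))
    (\<lambda>i. panels (colour_class c i)) (chamber_map n c)"
  unfolding cayley_isometric_embedding_def
proof (intro conjI ballI)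
  let ?A = "colour_class c"
  let ?V = "\<lambda>i. chambers (?A i)" and ?E = "\<lambda>i. panels (?A i)"
  have A: "?A i \<subseteq> S" for i
    by (auto simp: colour_class_def)
  show map_in: "chamber_map n c \<in> carrier G \<rightarrow> product_verts {1..n} ?V"
    unfolding chamber_map_def product_verts_def chambers_def by auto
  show "chamber_map n c ` e \<in> product_edges {1..n} ?V ?E" if "e \<in> cayley_edges G S" for e
  proof -
    obtain g s where gs: "g \<in> carrier G" "s \<in> S" "e = {g, g \<otimes> s}"
      using \<open>e \<in> cayley_edges G S\<close> unfolding cayley_edges_def by auto
    have s: "s \<in> carrier G" "g \<otimes> s \<in> carrier G" "c s \<in> {1..n}"
      using gs S_carrier c unfolding colouring_def by auto
    let ?x = "chamber_map n c g" and ?y = "chamber_map n c (g \<otimes> s)"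
    have "?x \<in> product_verts {1..n} ?V" "?y \<in> product_verts {1..n} ?V"
      using map_in gs s by auto
    moreover have "{?x (c s), ?y (c s)} \<in> ?E (c s)"
      using gs s unfolding chamber_map_def panels_def colour_class_def by auto
    \<comment> \<open>An edge labelled \<open>s\<close> crosses a wall of colour \<open>c s\<close>
      only, so the other coordinates stay fixed.\<close>
    moreover have "\<forall>j\<in>{1..n} - {c s}. ?x j = ?y j"
      using gs s unfolding chamber_map_def
      by (auto simp: chamber_eq_iff inversions_mult_gen colour_class_def)
    ultimately have "{?x, ?y} \<in> product_edges {1..n} ?V ?E"
      using s(3) unfolding product_edges_def by blast
    then show ?thesis
      using gs by simp
  qed
  fix g h assume gh: "g \<in> carrier G" "h \<in> carrier G"
  obtain w where w: "w \<in> lists S" "val w = inv g \<otimes> h" "\<And>A. A \<subseteq> S \<Longrightarrow> distinct (crossed A w)"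
    using reduced_word [of "inv g \<otimes> h"] gh by auto
  have "l1_dist {1..n} ?V ?E (chamber_map n c g) (chamber_map n c h)
      = (\<Sum>i\<in>{1..n}. card (inversions (?A i) (inv g \<otimes> h)))"
    unfolding l1_dist_def chamber_map_def
    using gh A chamber_graph_dist by (intro sum.cong) auto
  also have "\<dots> = (\<Sum>i\<in>{1..n}. length (filter (\<lambda>s. s \<in> ?A i) w))"
    using w A card_inversions_distinct by (metis (no_types))
  also have "\<dots> = graph_dist (carrier G) (cayley_edges G S) g h"
    using sum_colour_class [OF c w(1)] cayley_graph_dist [OF gh w(1,2)] w(3) by simp
  finally show "l1_dist {1..n} ?V ?E (chamber_map n c g) (chamber_map n c h)
      = graph_dist (carrier G) (cayley_edges G S) g h" .
qed

lemma chamber_map_equivariant: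
  "cayley_equivariant G {1..n} (\<lambda>i. translate (colour_class c i)) (chamber_map n c)"
  unfolding cayley_equivariant_def diagonal_action_def chamber_map_def
  by (auto simp: translate_chamber cong: restrict_cong)

end

theorem theorem1p1:
  fixes G :: "('a, 'b) monoid_scheme" and S :: "'a set" and n :: nat
  assumes "right_angled_coxeter_group G S"
    and "chromatic_number G S = n"
  shows "\<exists>(V :: nat \<Rightarrow> 'a set set) (E :: nat \<Rightarrow> 'a set set set)
            (\<phi> :: nat \<Rightarrow> 'a \<Rightarrow> 'a set \<Rightarrow> 'a set) (f :: 'a \<Rightarrow> nat \<Rightarrow> 'a set).
    (\<forall>i\<in>{1..n}. simplicial_tree (V i) (E i) \<and> simplicial_action G (V i) (E i) (\<phi> i)) \<and>
    cayley_isometric_embedding G S {1..n} V E f \<and>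
    cayley_equivariant G {1..n} \<phi> f"
proof -
  interpret racg G S
    using assms(1) unfolding racg_def racg_axioms_def right_angled_coxeter_group_def
      has_presentation_def by blast
  obtain c where c: "colouring G S n c"
    using colouring_exists assms(2) by auto
  have "simplicial_tree (chambers (colour_class c i)) (panels (colour_class c i)) \<and>
      simplicial_action G (chambers (colour_class c i)) (panels (colour_class c i))
        (translate (colour_class c i))" for i
    using chamber_tree translate_action independent_colour_class [OF c, of i]
    unfolding independent_def by blast
  then show ?thesis
    using chamber_map_isometric [OF c] chamber_map_equivariant [of n c]
    by (intro exI [of _ "\<lambda>i. chambers (colour_class c i)"] exI [of _ "\<lambda>i. panels (colour_class c i)"]
      exI [of _ "\<lambda>i. translate (colour_class c i)"] exI [of _ "chamber_map n c"]) simp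
qed

end
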